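(* The Birkhoff polytope $\Pi^n:=\{x\in\mathbb{R}_+^{n\times n}:\ \sum_i x_{i,j}=1 \text{ for all } j,\ \sum_j x_{i,j}=1\text{ for all } i\}$ has precisely $$\frac12\sum_{k=2}^n\binom nk^2k!\,(k-1)!\ \ \ge\ \ \frac1n\binom{n!}{2}$$ edge-directions.
   Context: $\mathbb{R}_+$ denotes the nonnegative reals. An edge-direction of a polytope is the direction of one of its edges, i.e. a nonzero scalar multiple of the difference of the two endpoints of an edge (1-dimensional face); edge-directions are counted up to nonzero scalar multiplication (so parallel edges give the same edge-direction, and a direction and its negative are identified). *)

theory Defs
  imports "HOL-Analysis.Analysis"
begin

definition birkhoff_polytope :: "(real ^ 'n ^ 'n) set" where
  "birkhoff_polytope =
     {x. (\<forall>i j. 0 \<le> x $ i $ j) \<and>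
         (\<forall>j. (\<Sum>i\<in>UNIV. x $ i $ j) = 1) \<and>
         (\<forall>i. (\<Sum>j\<in>UNIV. x $ i $ j) = 1)}"

(* An edge of a polytope is the segment joining its two endpoints; edge_of requires affine
   dimension 1, so u and v below are distinct and every edge-direction is nonzero. *)
definition edge_directions :: "'a::euclidean_space set \<Rightarrow> 'a set" where
  "edge_directions P =
     {d. \<exists>u v c. closed_segment u v edge_of P \<and> c \<noteq> 0 \<and> d = c *\<^sub>R (v - u)}"

definition parallel_rel :: "('a::real_vector \<times> 'a) set" where
  "parallel_rel = {(d, d'). \<exists>c. c \<noteq> 0 \<and> d' = c *\<^sub>R d}"

lemma equiv_parallel_rel: "equiv UNIV (parallel_rel :: ('a::real_vector \<times> 'a) set)"
proof (rule equivI)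
  show "refl (parallel_rel :: ('a \<times> 'a) set)"
    by (auto simp: refl_on_def parallel_rel_def intro: exI[of _ 1])
  show "sym (parallel_rel :: ('a \<times> 'a) set)"
  proof (rule symI)
    fix x y :: 'a assume "(x, y) \<in> parallel_rel"
    then obtain c where "c \<noteq> 0" "y = c *\<^sub>R x" by (auto simp: parallel_rel_def)
    then have "inverse c \<noteq> 0" "x = inverse c *\<^sub>R y" by auto
    then show "(y, x) \<in> parallel_rel" unfolding parallel_rel_def by blast
  qed
  show "trans (parallel_rel :: ('a \<times> 'a) set)"
  proof (rule transI)
    fix x y z :: 'a assume "(x, y) \<in> parallel_rel" "(y, z) \<in> parallel_rel"
    then obtain c d where "c \<noteq> 0" "y = c *\<^sub>R x" "d \<noteq> 0" "z = d *\<^sub>R y"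
      by (auto simp: parallel_rel_def)
    then have "d * c \<noteq> 0" "z = (d * c) *\<^sub>R x" by auto
    then show "(x, z) \<in> parallel_rel" unfolding parallel_rel_def by blast
  qed
qed simp

(* Edge-directions are counted up to nonzero scalar multiplication, i.e. as classes. *)
definition edge_direction_classes :: "'a::euclidean_space set \<Rightarrow> 'a set set" where
  "edge_direction_classes P = edge_directions P // parallel_rel"

end

theory Submission imports Defs begin

text \<open>
  Read a matrix entry \<open>(i, j)\<close> as the edge between row \<open>i\<close> and column \<open>j\<close> of the complete
  bipartite graph \<open>K\<^bsub>n,n\<^esub>\<close>. Up to scaling, the edge-directions of the Birkhoff polytope are the circuits of the
  system of row and column sum equations: the matrices that carry \<open>1\<close> and \<open>-1\<close> alternately along a
  cycle of \<open>K\<^bsub>n,n\<^esub>\<close> of length \<open>2k\<close>, \<open>k \<ge> 2\<close>, and \<open>0\<close> elsewhere.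

  Every edge-direction has this form (\<open>edge_parallel_to_cycle_matrix\<close>). The difference \<open>v - u\<close> of two
  doubly stochastic matrices has zero row and column sums, so from a negative entry one can always
  move along the column to a positive one and from there along the row to a negative one, until the
  walk closes up to a cycle. Where \<open>v - u\<close> is nonzero the midpoint of \<open>u\<close> and \<open>v\<close> is positive,
  so the midpoint can be moved a little both ways in the direction of the cycle matrix without
  leaving the polytope. If the segment from \<open>u\<close> to \<open>v\<close> is a face, it contains the moved points, which
  makes the cycle matrix parallel to \<open>v - u\<close>.

  Conversely, every cycle matrix is an edge-direction (\<open>cycle_matrix_is_edge\<close>). Extend the two
  perfect matchings of the cycle by one common matching of the remaining rows and columns to
  permutation matrices \<open>u\<close> and \<open>v\<close>. The doubly stochastic matrices supported on the union of the two
  supports form a face, and on such a support a single entry on the cycle determines the whole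
  matrix (\<open>cycle_rigidity\<close>), so this face is the segment from \<open>u\<close> to \<open>v\<close>.

  For the count, a cycle is written as its list of \<open>k\<close> rows together with its list of \<open>k\<close> columns.
  There are \<open>((n choose k) k!)\<^sup>2\<close> such pairs of lists, and a cycle matrix determines the pair up to
  a simultaneous rotation by one of \<open>k\<close> amounts (\<open>card_cycle_matrix_fibre\<close>). Cycle matrices have
  entries in \<open>{-1, 0, 1}\<close> and are closed under negation, so each parallel class contains exactly two
  of them, which gives the factor \<open>1/2\<close> (\<open>two_card_edge_direction_classes\<close>).

  The inequality holds because the summand for \<open>k = n\<close> alone is \<open>n! (n - 1)! = (n!)\<^sup>2 / n\<close>, while
  \<open>2 (n! choose 2) = n! (n! - 1)\<close>. For \<open>n = 1\<close> both sides are zero.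
\<close>

section \<open>Alternating cycles and their matrices\<close>

text \<open>
  The pair \<open>(xs, ys)\<close> stands for the closed walk
  \<open>xs ! 0, ys ! 1, xs ! 1, ys ! 2, \<dots>, xs ! (k - 1), ys ! 0, xs ! 0\<close> in \<open>K\<^bsub>n,n\<^esub>\<close>, with \<open>xs\<close> listing rows and \<open>ys\<close>
  columns. Its two perfect matchings are \<open>zip xs ys\<close> and \<open>zip xs (rotate1 ys)\<close>. For \<open>k = 1\<close> these
  coincide, which is why \<open>2 \<le> k\<close> is a premise of most results below.
\<close>
definition alternating_cycles :: "nat \<Rightarrow> ('a list \<times> 'a list) set" where
  "alternating_cycles k =
     {(xs, ys). length xs = k \<and> length ys = k \<and> distinct xs \<and> distinct ys}"

definition matching_matrix :: "'n::finite list \<Rightarrow> 'n list \<Rightarrow> real ^ 'n ^ 'n" where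
  "matching_matrix xs ys = (\<chi> i j. of_bool ((i, j) \<in> set (zip xs ys)))"

definition cycle_matrix :: "'n::finite list \<Rightarrow> 'n list \<Rightarrow> real ^ 'n ^ 'n" where
  "cycle_matrix xs ys = matching_matrix xs ys - matching_matrix xs (rotate1 ys)"

lemma nth_in_zip_iff:
  assumes "length xs = length ys" "distinct xs" "l < length xs"
  shows "(xs ! l, j) \<in> set (zip xs ys) \<longleftrightarrow> j = ys ! l"
  using assms by (auto simp: in_set_zip nth_eq_iff_index_eq)

lemma in_zip_nth_iff:
  assumes "length xs = length ys" "distinct ys" "l < length ys"
  shows "(i, ys ! l) \<in> set (zip xs ys) \<longleftrightarrow> i = xs ! l"
  using assms by (auto simp: in_set_zip nth_eq_iff_index_eq)

lemma matching_matrix_row_sum: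
  fixes xs ys :: "'n::finite list"
  assumes "length xs = length ys" "distinct xs"
  shows "(\<Sum>j\<in>UNIV. matching_matrix xs ys $ i $ j) = of_bool (i \<in> set xs)"
proof (cases "i \<in> set xs")
  case True
  then obtain l where l: "l < length xs" "i = xs ! l"
    by (auto simp: in_set_conv_nth)
  have "(i, j) \<in> set (zip xs ys) \<longleftrightarrow> j = ys ! l" for j
    using l assms by (auto simp: set_zip nth_eq_iff_index_eq)
  then show ?thesis
    using True by (simp add: matching_matrix_def of_bool_def)
next
  case False
  then have "(i, j) \<notin> set (zip xs ys)" for j
    by (auto dest: set_zip_leftD)
  then show ?thesis
    using False by (simp add: matching_matrix_def)
qed

lemma matching_matrix_column_sum:
  fixes xs ys :: "'n::finite list"
  assumes "length xs = length ys" "distinct ys"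
  shows "(\<Sum>i\<in>UNIV. matching_matrix xs ys $ i $ j) = of_bool (j \<in> set ys)"
proof -
  have "(i, j) \<in> set (zip xs ys) \<longleftrightarrow> (j, i) \<in> set (zip ys xs)" for i
    by (auto simp: in_set_zip)
  then have "(\<Sum>i\<in>UNIV. matching_matrix xs ys $ i $ j)
      = (\<Sum>i\<in>UNIV. matching_matrix ys xs $ j $ i)"
    by (simp add: matching_matrix_def)
  then show ?thesis
    using matching_matrix_row_sum[of ys xs j] assms by simp
qed

lemma matching_matrix_in_birkhoff_polytope:
  fixes xs ys :: "'n::finite list"
  assumes "length xs = length ys" "distinct xs" "distinct ys" "set xs = UNIV" "set ys = UNIV"
  shows "matching_matrix xs ys \<in> birkhoff_polytope"
  using assms
  by (auto simp: birkhoff_polytope_def matching_matrix_row_sum matching_matrix_column_sum)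
    (simp add: matching_matrix_def)

lemma cycle_matrix_row_sum:
  assumes "(xs, ys) \<in> alternating_cycles k"
  shows "(\<Sum>j\<in>UNIV. cycle_matrix xs ys $ i $ j) = 0"
  using assms
  by (simp add: cycle_matrix_def alternating_cycles_def sum_subtractf matching_matrix_row_sum)

lemma cycle_matrix_column_sum:
  assumes "(xs, ys) \<in> alternating_cycles k"
  shows "(\<Sum>i\<in>UNIV. cycle_matrix xs ys $ i $ j) = 0"
  using assms
  by (simp add: cycle_matrix_def alternating_cycles_def sum_subtractf matching_matrix_column_sum)

text \<open>
  This disjointness makes the positive and the negative entries of a cycle matrix readable off the
  matrix: nothing cancels in the difference of the two matchings.
\<close>
lemma set_zip_disjoint_rotate1:
  assumes "(xs, ys) \<in> alternating_cycles k" "2 \<le> k"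
  shows "set (zip xs ys) \<inter> set (zip xs (rotate1 ys)) = {}"
proof -
  have "l \<noteq> Suc l mod k" if "l < k" for l
    using that assms(2) by (cases "Suc l = k") auto
  moreover have "Suc l mod k < k" for l
    using assms(2) by simp
  ultimately show ?thesis
    using assms(1)
    by (auto simp: alternating_cycles_def set_zip nth_rotate1 nth_eq_iff_index_eq)
qed

lemma cycle_matrix_nth:
  assumes "(xs, ys) \<in> alternating_cycles k" "2 \<le> k"
  shows "cycle_matrix xs ys $ i $ j =
    (if (i, j) \<in> set (zip xs ys) then 1 else if (i, j) \<in> set (zip xs (rotate1 ys)) then -1 else 0)"
  using set_zip_disjoint_rotate1[OF assms]
  by (auto simp: cycle_matrix_def matching_matrix_def)

lemma cycle_matrix_nonzero:
  assumes "(xs, ys) \<in> alternating_cycles k" "2 \<le> k"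
  shows "cycle_matrix xs ys \<noteq> 0"
proof -
  have "(xs ! 0, ys ! 0) \<in> set (zip xs ys)"
    using assms by (force simp: alternating_cycles_def set_zip)
  then have "cycle_matrix xs ys $ (xs ! 0) $ (ys ! 0) = 1"
    using cycle_matrix_nth[OF assms] by simp
  then show ?thesis
    by auto
qed


section \<open>Cycle matrices are edge-directions\<close>

text \<open>
  Forcing entries to vanish cuts out a face because the entries are nonnegative: a proper convex
  combination of nonnegative numbers is zero only if both numbers are.
\<close>
lemma birkhoff_polytope_support_face:
  fixes S :: "('n::finite \<times> 'n) set"
  shows "{x \<in> birkhoff_polytope. \<forall>i j. (i, j) \<notin> S \<longrightarrow> x $ i $ j = 0}
           face_of (birkhoff_polytope :: (real ^ 'n ^ 'n) set)"
    (is "?F face_of ?B")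
  unfolding face_of_def
proof (intro conjI ballI impI)
  show "?F \<subseteq> ?B" by auto
  show "convex ?F"
    by (auto simp: convex_def birkhoff_polytope_def sum.distrib sum_distrib_left[symmetric])
  fix a b x
  assume a: "a \<in> ?B" and b: "b \<in> ?B" and x: "x \<in> ?F" and seg: "x \<in> open_segment a b"
  from seg obtain t where t: "0 < t" "t < 1" "x = (1 - t) *\<^sub>R a + t *\<^sub>R b"
    by (auto simp: in_segment)
  have *: "a $ i $ j = 0 \<and> b $ i $ j = 0" if "(i, j) \<notin> S" for i j
  proof -
    have "(1 - t) * a $ i $ j + t * b $ i $ j = 0"
      using x that t(3) by auto
    moreover have "0 \<le> a $ i $ j" "0 \<le> b $ i $ j"
      using a b by (auto simp: birkhoff_polytope_def)
    ultimately show ?thesis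
      using t(1,2) by (simp add: add_nonneg_eq_0_iff)
  qed
  then show "a \<in> ?F" "b \<in> ?F"
    using a b by auto
qed

text \<open>
  In a row or column with sum zero, all entries vanish as soon as all but one do. Off the cycle each
  row has only one admissible entry. On the cycle each row and each column has two, so the vanishing
  of the first one spreads along the cycle: from \<open>(xs ! l, ys ! l)\<close> through its row to
  \<open>(xs ! l, ys ! Suc l)\<close> and from there through its column to \<open>(xs ! Suc l, ys ! Suc l)\<close>.
\<close>
lemma cycle_rigidity:
  fixes w :: "real ^ 'n ^ 'n"
  assumes cyc: "(xs, ys) \<in> alternating_cycles k" and k: "0 < k"
    and ext: "distinct (xs @ as)" "distinct (ys @ bs)" "length as = length bs"
      "set (xs @ as) = UNIV"
    and row: "\<And>i. (\<Sum>j\<in>UNIV. w $ i $ j) = 0"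
    and col: "\<And>j. (\<Sum>i\<in>UNIV. w $ i $ j) = 0"
    and supp: "\<And>i j. w $ i $ j \<noteq> 0 \<Longrightarrow>
      (i, j) \<in> set (zip (xs @ as) (ys @ bs)) \<union> set (zip (xs @ as) (rotate1 ys @ bs))"
    and start: "w $ (xs ! 0) $ (ys ! 0) = 0"
  shows "w = 0"
proof -
  have len: "length xs = k" "length ys = k" and dist: "distinct xs" "distinct ys"
    using cyc by (auto simp: alternating_cycles_def)
  have row1: "w $ i $ j0 = 0" if "\<And>j. j \<noteq> j0 \<Longrightarrow> w $ i $ j = 0" for i j0
    using row[of i] that by (simp add: sum.remove[of UNIV j0])
  have col1: "w $ i0 $ j = 0" if "\<And>i. i \<noteq> i0 \<Longrightarrow> w $ i $ j = 0" for i0 j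
    using col[of j] that by (simp add: sum.remove[of UNIV i0])
  have S_outer: "j = bs ! l" if "w $ (as ! l) $ j \<noteq> 0" "l < length as" for l j
    using supp[OF that(1)] that(2) len ext
      nth_in_zip_iff[of "xs @ as" "ys @ bs" "k + l" j]
      nth_in_zip_iff[of "xs @ as" "rotate1 ys @ bs" "k + l" j]
    by (auto simp: nth_append)
  have S_row: "j = ys ! l \<or> j = rotate1 ys ! l" if "w $ (xs ! l) $ j \<noteq> 0" "l < k" for l j
    using supp[OF that(1)] that(2) len ext
      nth_in_zip_iff[of "xs @ as" "ys @ bs" l j]
      nth_in_zip_iff[of "xs @ as" "rotate1 ys @ bs" l j]
    by (auto simp: nth_append)
  have S_col: "i = xs ! Suc l \<or> i = xs ! l" if "w $ i $ (ys ! Suc l) \<noteq> 0" "Suc l < k" for l i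
    using supp[OF that(1)] that(2) len ext
      in_zip_nth_iff[of "xs @ as" "ys @ bs" "Suc l" i]
      in_zip_nth_iff[of "xs @ as" "rotate1 ys @ bs" l i]
    by (auto simp: nth_append nth_rotate1)
  have inner: "w $ (xs ! l) $ (ys ! l) = 0" if "l < k" for l
    using that
  proof (induction l)
    case 0
    then show ?case using start by simp
  next
    case (Suc l)
    then have 0: "w $ (xs ! l) $ (ys ! l) = 0" by simp
    have "w $ (xs ! l) $ (ys ! Suc l) = 0"
      using row1[of "ys ! Suc l" "xs ! l"] S_row[of l] 0 Suc.prems len
      by (metis Suc_lessD mod_less nth_rotate1)
    then show ?case
      using col1[of "xs ! Suc l" "ys ! Suc l"] S_col[of _ l] Suc.prems by metis
  qed
  show "w = 0"
  proof (rule ccontr)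
    assume "w \<noteq> 0"
    then obtain i j where ij: "w $ i $ j \<noteq> 0"
      by (auto simp: vec_eq_iff)
    have "i \<in> set xs \<or> i \<in> set as"
      using ext(4) by auto
    then consider l where "l < k" "i = xs ! l" | l where "l < length as" "i = as ! l"
      using len by (auto simp: in_set_conv_nth)
    then show False
    proof cases
      case 1
      have "w $ i $ (rotate1 ys ! l) = 0"
        using row1[of "rotate1 ys ! l" i] S_row[of l] inner 1 by metis
      then show False
        using S_row[of l j] inner[of l] ij 1 by auto
    next
      case 2
      have "w $ i $ (bs ! l) = 0"
        using row1[of "bs ! l" i] S_outer[of l] 2 by metis
      then show False
        using S_outer[of l j] ij 2 by auto
    qed
  qed
qed

lemma birkhoff_polytope_entry_le_1:
  assumes "x \<in> birkhoff_polytope"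
  shows "x $ i $ j \<le> 1"
proof -
  have "x $ i $ j \<le> (\<Sum>j\<in>UNIV. x $ i $ j)"
    using assms by (intro member_le_sum) (auto simp: birkhoff_polytope_def)
  then show ?thesis
    using assms by (simp add: birkhoff_polytope_def)
qed

text \<open>
  The endpoints are permutation matrices that agree off the cycle. A point \<open>x\<close> of the face they span
  is compared with the point of the segment that has the same entry at \<open>(xs ! 0, ys ! 0)\<close>. By rigidity
  the two are equal.
\<close>
lemma cycle_matrix_is_edge:
  fixes xs ys :: "'n::finite list"
  assumes cyc: "(xs, ys) \<in> alternating_cycles k" and k: "2 \<le> k"
  shows "\<exists>u v. closed_segment u v edge_of (birkhoff_polytope :: (real ^ 'n ^ 'n) set)
    \<and> v - u = cycle_matrix xs ys"
proof -
  have len: "length xs = k" "length ys = k" and dist: "distinct xs" "distinct ys"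
    using cyc by (auto simp: alternating_cycles_def)
  obtain as where as: "set as = UNIV - set xs" "distinct as"
    using finite_distinct_list[of "UNIV - set xs"] by auto
  obtain bs where bs: "set bs = UNIV - set ys" "distinct bs"
    using finite_distinct_list[of "UNIV - set ys"] by auto
  have lab: "length as = length bs"
    using as bs len dist
    by (metis card_Diff_subset distinct_card finite_set subset_UNIV)
  define S where "S = set (zip (xs @ as) (ys @ bs)) \<union> set (zip (xs @ as) (rotate1 ys @ bs))"
  define v where "v = matching_matrix (xs @ as) (ys @ bs)"
  define u where "u = matching_matrix (xs @ as) (rotate1 ys @ bs)"
  define F where "F = {x \<in> birkhoff_polytope. \<forall>i j. (i, j) \<notin> S \<longrightarrow> x $ i $ j = 0}"
  have F: "F face_of birkhoff_polytope"
    unfolding F_def by (rule birkhoff_polytope_support_face)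
  have uv: "v \<in> F" "u \<in> F"
    using as bs len dist lab
    by (auto simp: F_def u_def v_def S_def intro!: matching_matrix_in_birkhoff_polytope)
      (auto simp: matching_matrix_def)
  have diff: "v - u = cycle_matrix xs ys"
  proof -
    have "(i, j) \<notin> set (zip as bs)" if "(i, j) \<in> set (zip xs ys) \<or> (i, j) \<in> set (zip xs (rotate1 ys))" for i j
      using that as by (auto dest!: set_zip_leftD)
    then show ?thesis
      using len by (auto simp: u_def v_def cycle_matrix_def matching_matrix_def vec_eq_iff)
  qed
  have "F \<subseteq> closed_segment u v"
  proof
    fix x assume x: "x \<in> F"
    then have xB: "x \<in> birkhoff_polytope" by (simp add: F_def)
    \<comment> \<open>At this entry \<open>u\<close> is 0 and \<open>v\<close> is 1, so it is the parameter of \<open>x\<close> on the segment.\<close>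
    define t where "t = x $ (xs ! 0) $ (ys ! 0)"
    define w where "w = x - ((1 - t) *\<^sub>R u + t *\<^sub>R v)"
    have uvB: "u \<in> birkhoff_polytope" "v \<in> birkhoff_polytope"
      using uv by (auto simp: F_def)
    have "(xs ! 0, ys ! 0) \<in> set (zip xs ys)"
      using len k by (force simp: set_zip)
    then have c0: "cycle_matrix xs ys $ (xs ! 0) $ (ys ! 0) = 1"
      using cycle_matrix_nth[OF cyc k] by simp
    have v0: "v $ (xs ! 0) $ (ys ! 0) = 1"
      using \<open>(xs ! 0, ys ! 0) \<in> _\<close> len by (simp add: v_def matching_matrix_def)
    have u0: "u $ (xs ! 0) $ (ys ! 0) = 0"
      using c0 v0 unfolding diff[symmetric] by simp
    have "w = 0"
    proof (rule cycle_rigidity[OF cyc])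
      show "0 < k" using k by simp
      show "distinct (xs @ as)" "distinct (ys @ bs)" "length as = length bs" "set (xs @ as) = UNIV"
        using as bs dist lab by auto
      show "(\<Sum>j\<in>UNIV. w $ i $ j) = 0" for i
        using xB uvB
        by (simp add: w_def birkhoff_polytope_def sum_subtractf sum.distrib sum_distrib_left[symmetric])
      show "(\<Sum>i\<in>UNIV. w $ i $ j) = 0" for j
        using xB uvB
        by (simp add: w_def birkhoff_polytope_def sum_subtractf sum.distrib sum_distrib_left[symmetric])
      show "(i, j) \<in> set (zip (xs @ as) (ys @ bs)) \<union> set (zip (xs @ as) (rotate1 ys @ bs))"
        if "w $ i $ j \<noteq> 0" for i j
      proof (rule ccontr)
        assume "\<not> ?thesis"
        then have "(i, j) \<notin> S" by (simp add: S_def)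
        then have "w $ i $ j = 0"
          using x uv by (simp add: F_def w_def)
        with that show False by simp
      qed
      show "w $ (xs ! 0) $ (ys ! 0) = 0"
        by (simp add: w_def t_def u0 v0)
    qed
    then have "x = (1 - t) *\<^sub>R u + t *\<^sub>R v" by (simp add: w_def)
    moreover have "0 \<le> t" "t \<le> 1"
      using xB birkhoff_polytope_entry_le_1[OF xB] by (auto simp: t_def birkhoff_polytope_def)
    ultimately show "x \<in> closed_segment u v" by (auto simp: in_segment)
  qed
  moreover have "closed_segment u v \<subseteq> F"
    using uv face_of_imp_convex[OF F] by (simp add: closed_segment_subset)
  ultimately have "closed_segment u v face_of birkhoff_polytope"
    using F by simp
  moreover have "u \<noteq> v"
    using diff cycle_matrix_nonzero[OF cyc k] by auto
  ultimately have "closed_segment u v edge_of birkhoff_polytope"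
    by (simp add: edge_of_def segment_convex_hull aff_dim_convex_hull)
  with diff show ?thesis by blast
qed

section \<open>Every edge-direction comes from a cycle\<close>

text \<open>
  Iterating a self-map of a finite set must repeat a value. Taking the least distance \<open>k\<close> between two
  equal iterates, over all starting positions, makes the \<open>k\<close> iterates in between distinct.
\<close>
lemma periodic_point_with_distinct_orbit:
  fixes f :: "'a \<Rightarrow> 'a"
  assumes "finite A" "a \<in> A" "f ` A \<subseteq> A"
  obtains b k where "0 < k" "(f ^^ k) b = b" "distinct (map (\<lambda>l. (f ^^ l) b) [0..<k])"
    "\<And>l. (f ^^ l) b \<in> A"
proof -
  have orb: "(f ^^ l) a \<in> A" for l
    using assms(2,3) by (induction l) auto
  then have "\<not> inj (\<lambda>l. (f ^^ l) a)"
    using finite_subset[OF _ assms(1), of "range (\<lambda>l. (f ^^ l) a)"]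
    by (auto dest: finite_imageD)
  then obtain p q where "p < q" "(f ^^ p) a = (f ^^ q) a"
    by (metis injI linorder_neqE_nat)
  then have "\<exists>k>0. \<exists>p. (f ^^ (p + k)) a = (f ^^ p) a"
    by (intro exI[of _ "q - p"] conjI exI[of _ p]) auto
  define P where "P k \<longleftrightarrow> 0 < k \<and> (\<exists>p. (f ^^ (p + k)) a = (f ^^ p) a)" for k
  define k where "k = (LEAST k. P k)"
  have "\<exists>k. P k"
    using \<open>\<exists>k>0. _ k\<close> unfolding P_def by blast
  then have "P k"
    unfolding k_def by (rule LeastI_ex)
  then obtain p where p: "0 < k" "(f ^^ (p + k)) a = (f ^^ p) a"
    by (auto simp: P_def)
  have least: "\<not> P m" if "m < k" for m
    using that not_less_Least unfolding k_def by blast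
  define b where "b = (f ^^ p) a"
  have b: "(f ^^ l) b = (f ^^ (p + l)) a" for l
    by (simp add: b_def funpow_add[symmetric] add.commute flip: comp_apply[of "f ^^ _" "f ^^ _"])
  have ne: "(f ^^ i) b \<noteq> (f ^^ j) b" if "i < j" "j < k" for i j
  proof
    assume "(f ^^ i) b = (f ^^ j) b"
    then have "(f ^^ ((p + i) + (j - i))) a = (f ^^ (p + i)) a"
      using that by (simp add: b)
    then have "P (j - i)"
      using that unfolding P_def by (metis zero_less_diff)
    then show False
      using least[of "j - i"] that by simp
  qed
  show ?thesis
  proof
    show "0 < k" by fact
    show "(f ^^ k) b = b" unfolding b using p(2) by (simp add: b_def)
    show "distinct (map (\<lambda>l. (f ^^ l) b) [0..<k])"
      unfolding distinct_map by (auto simp: inj_on_def) (metis ne linorder_neqE_nat)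
    show "(f ^^ l) b \<in> A" for l
      by (simp add: b orb)
  qed
qed

text \<open>
  In a matrix with zero row and column sums, every column with a negative entry has a positive one,
  in some row \<open>h j\<close>, and that row has a negative entry, in some column \<open>g (h j)\<close>. A periodic orbit of
  \<open>g \<circ> h\<close> on the columns gives the cycle.
\<close>
lemma alternating_cycle_exists:
  fixes d :: "real ^ 'n ^ 'n"
  assumes row: "\<And>i. (\<Sum>j\<in>UNIV. d $ i $ j) = 0"
    and col: "\<And>j. (\<Sum>i\<in>UNIV. d $ i $ j) = 0"
    and "d \<noteq> 0"
  obtains k xs ys where "2 \<le> k" "(xs, ys) \<in> alternating_cycles k"
    "\<And>i j. (i, j) \<in> set (zip xs ys) \<Longrightarrow> 0 < d $ i $ j"
    "\<And>i j. (i, j) \<in> set (zip xs (rotate1 ys)) \<Longrightarrow> d $ i $ j < 0"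
proof -
  have pos_ex: "\<exists>a. 0 < f a" if "(\<Sum>a\<in>UNIV. f a) = 0" "f b < 0" for f :: "'n \<Rightarrow> real" and b
    using that sum_nonneg_eq_0_iff[of UNIV "\<lambda>a. - f a"]
    by (auto simp: sum_negf) (metis not_le less_irrefl)
  have neg_ex: "\<exists>a. f a < 0" if "(\<Sum>a\<in>UNIV. f a) = 0" "0 < f b" for f :: "'n \<Rightarrow> real" and b
    using pos_ex[of "\<lambda>a. - f a" b] that by (simp add: sum_negf)
  obtain i j where "d $ i $ j \<noteq> 0"
    using \<open>d \<noteq> 0\<close> by (auto simp: vec_eq_iff)
  then obtain j0 where j0: "\<exists>i. d $ i $ j0 < 0"
    using neg_ex[of "\<lambda>j. d $ i $ j" j] row by (metis linorder_neqE_linordered_idom)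
  define A where "A = {j. \<exists>i. d $ i $ j < 0}"
  define h where "h j = (SOME i. 0 < d $ i $ j)" for j
  define g where "g i = (SOME j. d $ i $ j < 0)" for i
  have h: "0 < d $ h j $ j" if "j \<in> A" for j
  proof -
    have "\<exists>i. 0 < d $ i $ j"
      using that pos_ex[of "\<lambda>i. d $ i $ j"] col by (auto simp: A_def)
    then show ?thesis unfolding h_def by (rule someI_ex)
  qed
  have g: "d $ h j $ g (h j) < 0" if "j \<in> A" for j
  proof -
    have "\<exists>j'. d $ h j $ j' < 0"
      using h[OF that] neg_ex[of "\<lambda>j'. d $ h j $ j'"] row by auto
    then show ?thesis unfolding g_def by (rule someI_ex)
  qed
  have "(g \<circ> h) ` A \<subseteq> A"
    using g by (auto simp: A_def)
  moreover have "finite A" "j0 \<in> A"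
    using j0 by (auto simp: A_def)
  ultimately obtain b k where k: "0 < k" "((g \<circ> h) ^^ k) b = b"
      "distinct (map (\<lambda>l. ((g \<circ> h) ^^ l) b) [0..<k])" and A: "\<And>l. ((g \<circ> h) ^^ l) b \<in> A"
    by (metis periodic_point_with_distinct_orbit)
  define ys where "ys = map (\<lambda>l. ((g \<circ> h) ^^ l) b) [0..<k]"
  define xs where "xs = map h ys"
  have ysA: "ys ! l \<in> A" if "l < length ys" for l
    using A that by (auto simp: ys_def)
  have rot: "rotate1 ys = map g xs"
  proof (rule nth_equalityI)
    show "length (rotate1 ys) = length (map g xs)" by (simp add: xs_def)
    fix l assume "l < length (rotate1 ys)"
    then have l: "l < k" by (simp add: ys_def)
    then have "((g \<circ> h) ^^ (Suc l mod k)) b = g (h (((g \<circ> h) ^^ l) b))"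
      using k(2) by (cases "Suc l = k") auto
    then show "rotate1 ys ! l = map g xs ! l"
      using l by (simp add: xs_def ys_def nth_rotate1)
  qed
  \<comment> \<open>The rows are distinct since \<open>g\<close> maps them to the distinct columns of the orbit.\<close>
  have "distinct (map g xs)"
    using k(3) unfolding rot[symmetric] by (simp add: ys_def)
  then have "distinct xs" by (simp add: distinct_map)
  then have cyc: "(xs, ys) \<in> alternating_cycles k"
    using k(3) by (simp add: alternating_cycles_def xs_def ys_def)
  have pos: "0 < d $ i $ j" if "(i, j) \<in> set (zip xs ys)" for i j
    using that ysA h by (auto simp: xs_def in_set_zip)
  have neg: "d $ i $ j < 0" if "(i, j) \<in> set (zip xs (rotate1 ys))" for i j
    using that ysA g unfolding rot by (auto simp: xs_def in_set_zip)
  \<comment> \<open>A cycle with one row would put a positive and a negative entry in the same place.\<close>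
  have "k \<noteq> 1"
  proof
    assume "k = 1"
    then have "ys = [b]" by (simp add: ys_def)
    then show False
      using pos[of "h b" b] neg[of "h b" b] by (simp add: xs_def)
  qed
  with k(1) have "2 \<le> k" by simp
  from that[OF this cyc pos neg] show ?thesis .
qed

text \<open>
  The amount \<open>\<epsilon>\<close> by which the midpoint is moved is its smallest entry on the cycle. It is positive
  because an entry at which \<open>u\<close> and \<open>v\<close> differ is positive in at least one of them.
\<close>
lemma edge_parallel_to_cycle_matrix:
  fixes u v :: "real ^ 'n ^ 'n"
  assumes "closed_segment u v edge_of birkhoff_polytope"
  obtains k xs ys c where "2 \<le> k" "(xs, ys) \<in> alternating_cycles k" "c \<noteq> 0"
    "v - u = c *\<^sub>R cycle_matrix xs ys"
proof -
  have face: "closed_segment u v face_of birkhoff_polytope" and dim: "aff_dim (closed_segment u v) = 1"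
    using assms by (auto simp: edge_of_def)
  have "u \<noteq> v"
    using dim by auto
  have uv: "u \<in> birkhoff_polytope" "v \<in> birkhoff_polytope"
    using face_of_imp_subset[OF face] by auto
  obtain k xs ys where k: "2 \<le> k" and cyc: "(xs, ys) \<in> alternating_cycles k"
    and pos: "\<And>i j. (i, j) \<in> set (zip xs ys) \<Longrightarrow> 0 < (v - u) $ i $ j"
    and neg: "\<And>i j. (i, j) \<in> set (zip xs (rotate1 ys)) \<Longrightarrow> (v - u) $ i $ j < 0"
    using alternating_cycle_exists[of "v - u"] \<open>u \<noteq> v\<close> uv
    by (auto simp: birkhoff_polytope_def sum_subtractf)
  define C where "C = cycle_matrix xs ys"
  define m where "m = midpoint u v"
  define S where "S = set (zip xs ys) \<union> set (zip xs (rotate1 ys))"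
  define \<epsilon> where "\<epsilon> = Min ((\<lambda>(i, j). m $ i $ j) ` S)"
  have C0: "C \<noteq> 0"
    unfolding C_def by (rule cycle_matrix_nonzero[OF cyc k])
  have nonneg: "0 \<le> u $ i $ j" "0 \<le> v $ i $ j" for i j
    using uv by (auto simp: birkhoff_polytope_def)
  have m: "m $ i $ j = (u $ i $ j + v $ i $ j) / 2" for i j
    by (simp add: m_def midpoint_def)
  have mS: "0 < m $ i $ j" if "(i, j) \<in> S" for i j
  proof -
    have "(v - u) $ i $ j \<noteq> 0"
      using that pos neg by (fastforce simp: S_def)
    then show ?thesis
      using nonneg[of i j] by (simp add: m)
  qed
  have S: "finite S" "S \<noteq> {}"
    using cyc k by (auto simp: S_def alternating_cycles_def)
  have \<epsilon>: "0 < \<epsilon>"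
    using S mS by (auto simp: \<epsilon>_def)
  have \<epsilon>_le: "\<epsilon> \<le> m $ i $ j" if "(i, j) \<in> S" for i j
    using S that by (force simp: \<epsilon>_def intro!: Min_le)
  have mB: "m \<in> birkhoff_polytope"
    using face_of_imp_subset[OF face] by (auto simp: m_def)
  have perturb: "m + s *\<^sub>R C \<in> birkhoff_polytope" if "\<bar>s\<bar> \<le> \<epsilon>" for s
  proof -
    have "0 \<le> m $ i $ j + s * C $ i $ j" for i j
    proof (cases "(i, j) \<in> S")
      case True
      then have "\<bar>C $ i $ j\<bar> = 1"
        by (auto simp: S_def C_def cycle_matrix_nth[OF cyc k])
      then have "\<bar>s * C $ i $ j\<bar> \<le> \<epsilon>"
        using that by (simp add: abs_mult)
      then show ?thesis
        using \<epsilon>_le[OF True] by linarith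
    next
      case False
      then show ?thesis
        using nonneg[of i j] by (simp add: S_def C_def cycle_matrix_nth[OF cyc k] m)
    qed
    then show ?thesis
      using mB cycle_matrix_row_sum[OF cyc] cycle_matrix_column_sum[OF cyc]
      by (simp add: birkhoff_polytope_def sum.distrib sum_distrib_left[symmetric] C_def)
  qed
  have "m = midpoint (m - \<epsilon> *\<^sub>R C) (m + \<epsilon> *\<^sub>R C)"
    by (simp add: midpoint_def flip: scaleR_add_right scaleR_2)
  moreover have "m - \<epsilon> *\<^sub>R C \<noteq> m + \<epsilon> *\<^sub>R C"
  proof
    assume "m - \<epsilon> *\<^sub>R C = m + \<epsilon> *\<^sub>R C"
    then have "(2 * \<epsilon>) *\<^sub>R C = 0"
      by (simp add: algebra_simps flip: scaleR_2)
    with \<epsilon> C0 show False by simp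
  qed
  ultimately have "m \<in> open_segment (m - \<epsilon> *\<^sub>R C) (m + \<epsilon> *\<^sub>R C)"
    by (metis midpoint_in_open_segment)
  moreover have "m - \<epsilon> *\<^sub>R C \<in> birkhoff_polytope" "m + \<epsilon> *\<^sub>R C \<in> birkhoff_polytope"
    using perturb[of "- \<epsilon>"] perturb[of \<epsilon>] \<epsilon> by simp_all
  moreover have "m \<in> closed_segment u v"
    by (simp add: m_def)
  ultimately have "m + \<epsilon> *\<^sub>R C \<in> closed_segment u v"
    using face unfolding face_of_def by blast
  then obtain t where t: "m + \<epsilon> *\<^sub>R C = (1 - t) *\<^sub>R u + t *\<^sub>R v"
    by (auto simp: in_segment)
  have "(t - 1 / 2) *\<^sub>R (v - u) = ((1 - t) *\<^sub>R u + t *\<^sub>R v) - m"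
    by (simp add: vec_eq_iff m field_simps)
  then have eq: "(t - 1 / 2) *\<^sub>R (v - u) = \<epsilon> *\<^sub>R C"
    unfolding t[symmetric] by simp
  have "t - 1 / 2 \<noteq> 0"
  proof
    assume "t - 1 / 2 = 0"
    with eq have "\<epsilon> *\<^sub>R C = 0" by (metis scaleR_zero_left)
    with \<epsilon> C0 show False by simp
  qed
  then have "v - u = (1 / (t - 1 / 2)) *\<^sub>R ((t - 1 / 2) *\<^sub>R (v - u))"
    by simp
  then have "v - u = (\<epsilon> / (t - 1 / 2)) *\<^sub>R C"
    unfolding eq by simp
  then show ?thesis
    using that[OF k cyc, of "\<epsilon> / (t - 1 / 2)"] \<open>t - 1 / 2 \<noteq> 0\<close> \<epsilon> by (simp add: C_def)
qed

section \<open>Counting cycle matrices\<close>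

lemma cycle_matrix_eq_iff:
  assumes "(xs, ys) \<in> alternating_cycles k" "2 \<le> k"
    and "(xs', ys') \<in> alternating_cycles k'" "2 \<le> k'"
  shows "cycle_matrix xs ys = cycle_matrix xs' ys' \<longleftrightarrow>
    set (zip xs ys) = set (zip xs' ys') \<and> set (zip xs (rotate1 ys)) = set (zip xs' (rotate1 ys'))"
    (is "?l \<longleftrightarrow> ?r")
proof
  have pos: "(i, j) \<in> set (zip xs ys) \<longleftrightarrow> 0 < cycle_matrix xs ys $ i $ j"
    and neg: "(i, j) \<in> set (zip xs (rotate1 ys)) \<longleftrightarrow> cycle_matrix xs ys $ i $ j < 0"
    if "(xs, ys) \<in> alternating_cycles k" "2 \<le> k" for xs ys :: "'a list" and k i j
    using set_zip_disjoint_rotate1[OF that] by (auto simp: cycle_matrix_nth[OF that])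
  show ?r if ?l
    using pos neg assms that by (auto simp: set_eq_iff)
  show ?l if ?r
    using that by (simp add: cycle_matrix_def matching_matrix_def)
qed

lemma cycle_matrix_length_unique:
  assumes "(xs, ys) \<in> alternating_cycles k" "2 \<le> k"
    and "(xs', ys') \<in> alternating_cycles k'" "2 \<le> k'"
    and "cycle_matrix xs ys = cycle_matrix xs' ys'"
  shows "k = k'"
proof -
  have "card (set (zip xs ys)) = k" if "(xs, ys) \<in> alternating_cycles k" for xs ys :: "'a list" and k
    using that by (auto simp: alternating_cycles_def distinct_card distinct_zipI1)
  then show ?thesis
    using assms cycle_matrix_eq_iff[OF assms(1-4)] by metis
qed

text \<open>
  Once the starting row is fixed, the rest of the cycle is forced: the negative entry in row
  \<open>xs ! l\<close> gives the next column, and the positive entry in that column gives the next row.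
\<close>
lemma cycle_matrix_determines_lists:
  assumes cyc: "(xs, ys) \<in> alternating_cycles k" and k: "2 \<le> k"
    and cyc': "(xs', ys') \<in> alternating_cycles k"
    and eq: "cycle_matrix xs ys = cycle_matrix xs' ys'"
    and start: "xs ! 0 = xs' ! 0"
  shows "xs = xs' \<and> ys = ys'"
proof -
  have len: "length xs = k" "length ys = k" "length xs' = k" "length ys' = k"
    and dist: "distinct xs" "distinct ys"
    using cyc cyc' by (auto simp: alternating_cycles_def)
  have zips: "set (zip xs ys) = set (zip xs' ys')"
      "set (zip xs (rotate1 ys)) = set (zip xs' (rotate1 ys'))"
    using eq cycle_matrix_eq_iff[OF cyc k cyc' k] by auto
  have pos: "(xs' ! l, ys' ! l) \<in> set (zip xs ys)" if "l < k" for l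
    using that len unfolding zips by (auto simp: in_set_zip)
  have neg: "(xs' ! l, rotate1 ys' ! l) \<in> set (zip xs (rotate1 ys))" if "l < k" for l
    using that len unfolding zips by (auto simp: in_set_zip)
  have "xs' ! l = xs ! l \<and> ys' ! l = ys ! l" if "l < k" for l
    using that
  proof (induction l)
    case 0
    have "(xs ! 0, ys' ! 0) \<in> set (zip xs ys)"
      using pos[of 0] 0 start by simp
    then show ?case
      using nth_in_zip_iff[of xs ys 0] len dist 0 start by simp
  next
    case (Suc l)
    then have "(xs ! l, ys' ! Suc l) \<in> set (zip xs (rotate1 ys))"
      using neg[of l] len by (simp add: nth_rotate1)
    then have "ys' ! Suc l = ys ! Suc l"
      using nth_in_zip_iff[of xs "rotate1 ys" l] len dist Suc.prems by (simp add: nth_rotate1)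
    then show ?case
      using pos[of "Suc l"] in_zip_nth_iff[of xs ys "Suc l"] len dist Suc.prems by simp
  qed
  then show ?thesis
    using len by (auto intro: nth_equalityI)
qed

lemma rotate_alternating_cycle:
  assumes "(xs, ys) \<in> alternating_cycles k"
  shows "(rotate i xs, rotate i ys) \<in> alternating_cycles k"
  using assms by (simp add: alternating_cycles_def)

lemma cycle_matrix_rotate:
  fixes xs ys :: "'n::finite list"
  assumes "(xs, ys) \<in> alternating_cycles k"
  shows "cycle_matrix (rotate i xs) (rotate i ys) = cycle_matrix xs ys"
proof -
  have zip_rotate: "zip (rotate i xs) (rotate i zs) = rotate i (zip xs zs)" if "length zs = length xs" for zs :: "'n list"
  proof (rule nth_equalityI)
    fix l assume l: "l < length (zip (rotate i xs) (rotate i zs))"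
    then have "(i + l) mod length xs < length xs"
      by (intro mod_less_divisor) auto
    with l show "zip (rotate i xs) (rotate i zs) ! l = rotate i (zip xs zs) ! l"
      using that by (simp add: nth_rotate)
  qed (use that in simp)
  have "set (zip (rotate i xs) (rotate i zs)) = set (zip xs zs)" if "length zs = length xs" for zs :: "'n list"
    unfolding zip_rotate[OF that] by simp
  then show ?thesis
    using assms
    by (simp add: cycle_matrix_def matching_matrix_def alternating_cycles_def rotate1_rotate_swap)
qed

text \<open>
  Two pairs of lists with the same matrix run through the same cycle in the same sense, since the
  signs fix the sense. They can differ only in the starting row, and each of the \<open>k\<close> rows is possible.
\<close>
lemma card_cycle_matrix_fibre:
  assumes cyc: "(xs, ys) \<in> alternating_cycles k" and k: "2 \<le> k"
  shows "card {p \<in> alternating_cycles k. case_prod cycle_matrix p = cycle_matrix xs ys} = k"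
proof -
  have len: "length xs = k" "length ys = k" and dist: "distinct xs" "distinct ys"
    using cyc by (auto simp: alternating_cycles_def)
  have nth0: "rotate i xs ! 0 = xs ! i" if "i < k" for i
    using that len by (subst nth_rotate) auto
  have "{p \<in> alternating_cycles k. case_prod cycle_matrix p = cycle_matrix xs ys}
      = (\<lambda>i. (rotate i xs, rotate i ys)) ` {..<k}" (is "?L = ?R")
  proof (intro equalityI subsetI)
    fix p assume "p \<in> ?L"
    then obtain xs' ys' where p: "p = (xs', ys')" "(xs', ys') \<in> alternating_cycles k"
        "cycle_matrix xs' ys' = cycle_matrix xs ys"
      by (cases p) auto
    have "(xs' ! 0, ys' ! 0) \<in> set (zip xs' ys')"
      using p(2) k by (force simp: alternating_cycles_def in_set_zip)
    also have "set (zip xs' ys') = set (zip xs ys)"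
      using p(3) cycle_matrix_eq_iff[OF p(2) k cyc k] by simp
    finally obtain i where i: "i < k" "xs ! i = xs' ! 0"
      using len by (auto simp: in_set_zip)
    have "rotate i xs = xs' \<and> rotate i ys = ys'"
      using i p cyc k nth0
      by (intro cycle_matrix_determines_lists[where k = k])
        (auto simp: rotate_alternating_cycle cycle_matrix_rotate)
    then show "p \<in> ?R"
      using i p(1) by auto
  qed (use rotate_alternating_cycle[OF cyc] cycle_matrix_rotate[OF cyc] in auto)
  moreover have "inj_on (\<lambda>i. (rotate i xs, rotate i ys)) {..<k}"
  proof (rule inj_onI)
    fix i j assume "i \<in> {..<k}" "j \<in> {..<k}" "(rotate i xs, rotate i ys) = (rotate j xs, rotate j ys)"
    then have "xs ! i = xs ! j" "i < k" "j < k"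
      using nth0 by (metis lessThan_iff prod.inject)+
    then show "i = j"
      using dist len by (simp add: nth_eq_iff_index_eq)
  qed
  ultimately show ?thesis
    by (simp add: card_image)
qed

lemma card_alternating_cycles:
  assumes "k \<le> CARD('n::finite)"
  shows "card (alternating_cycles k :: ('n list \<times> 'n list) set) = ((CARD('n) choose k) * fact k)\<^sup>2"
    and "finite (alternating_cycles k :: ('n list \<times> 'n list) set)"
proof -
  define L where "L = {xs :: 'n list. length xs = k \<and> distinct xs}"
  have "alternating_cycles k = L \<times> L"
    by (auto simp: alternating_cycles_def L_def)
  moreover have "card L = (CARD('n) choose k) * fact k"
  proof -
    have "fact (CARD('n) - k) * card L = (fact (CARD('n)) :: nat)"
    proof -
      have "card L = \<Prod>{CARD('n) - k + 1..CARD('n)}"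
        using card_lists_distinct_length_eq[of "UNIV :: 'n set" k] assms by (simp add: L_def)
      also have "\<dots> = fact (CARD('n)) div fact (CARD('n) - k)"
        using fact_div_fact[of "CARD('n) - k" "CARD('n)"] by simp
      finally show ?thesis
        by (simp add: fact_dvd)
    qed
    also have "\<dots> = fact (CARD('n) - k) * ((CARD('n) choose k) * fact k)"
      using binomial_fact_lemma[OF assms] by (simp add: ac_simps)
    finally show ?thesis by simp
  qed
  moreover have "finite L"
    using finite_lists_length_eq[of "UNIV :: 'n set" k]
    by (rule rev_finite_subset) (auto simp: L_def)
  ultimately show "card (alternating_cycles k :: ('n list \<times> 'n list) set) = ((CARD('n) choose k) * fact k)\<^sup>2"
    and "finite (alternating_cycles k :: ('n list \<times> 'n list) set)"
    by (simp_all add: card_cartesian_product power2_eq_square)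
qed

definition cycle_directions :: "nat \<Rightarrow> (real ^ 'n ^ 'n::finite) set" where
  "cycle_directions k = case_prod cycle_matrix ` alternating_cycles k"

lemma card_cycle_directions:
  assumes k: "2 \<le> k" "k \<le> CARD('n::finite)"
  shows "card (cycle_directions k :: (real ^ 'n ^ 'n) set)
    = (CARD('n) choose k)\<^sup>2 * fact k * fact (k - 1)"
proof -
  let ?A = "alternating_cycles k :: ('n list \<times> 'n list) set"
  have "card ?A = (\<Sum>d\<in>case_prod cycle_matrix ` ?A. card {p \<in> ?A. case_prod cycle_matrix p = d})"
    using sum.image_gen[OF card_alternating_cycles(2)[OF k(2)], of "\<lambda>_. 1" "case_prod cycle_matrix"]
    by (simp only: card_eq_sum)
  also have "\<dots> = (\<Sum>d\<in>case_prod cycle_matrix ` ?A. k)"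
    using card_cycle_matrix_fibre[OF _ k(1)] by (intro sum.cong) auto
  finally have "k * card (cycle_directions k :: (real ^ 'n ^ 'n) set) = card ?A"
    by (simp add: cycle_directions_def)
  also have "\<dots> = k * ((CARD('n) choose k)\<^sup>2 * fact k * fact (k - 1))"
    using k fact_reduce[of k, where 'a = nat]
    by (simp add: card_alternating_cycles power2_eq_square algebra_simps)
  finally show ?thesis
    using k(1) by simp
qed

text \<open>
  Negation exchanges the two matchings of the cycle, that is, it reverses the sense of traversal.
\<close>
lemma cycle_directions_uminus:
  assumes "d \<in> cycle_directions k"
  shows "- d \<in> cycle_directions k"
proof -
  obtain xs ys where cyc: "(xs, ys) \<in> alternating_cycles k" and d: "d = cycle_matrix xs ys"
    using assms by (auto simp: cycle_directions_def)
  \<comment> \<open>Reversal inverts rotation, so the columns and their rotation change places.\<close>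
  have "rotate1 (rev (rotate1 ys)) = rev ys"
    by (cases ys) auto
  then have "cycle_matrix (rev xs) (rev (rotate1 ys)) = - d"
    using cyc by (simp add: d cycle_matrix_def matching_matrix_def zip_rev alternating_cycles_def)
  moreover have "(rev xs, rev (rotate1 ys)) \<in> alternating_cycles k"
    using cyc by (simp add: alternating_cycles_def)
  ultimately show ?thesis
    unfolding cycle_directions_def by force
qed

text \<open>
  The matrix on the right has an entry 1, so the factor is itself an entry of the matrix on the left.
\<close>
lemma parallel_cycle_matrices:
  assumes "(xs, ys) \<in> alternating_cycles k" "2 \<le> k"
    and "(xs', ys') \<in> alternating_cycles k'" "2 \<le> k'"
    and "cycle_matrix xs' ys' = c *\<^sub>R cycle_matrix xs ys"
  shows "c \<in> {-1, 0, 1}"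
proof -
  have "(xs ! 0, ys ! 0) \<in> set (zip xs ys)"
    using assms(1,2) by (force simp: alternating_cycles_def in_set_zip)
  then have "c = cycle_matrix xs' ys' $ (xs ! 0) $ (ys ! 0)"
    using assms(5) cycle_matrix_nth[OF assms(1,2)] by simp
  then show ?thesis
    using cycle_matrix_nth[OF assms(3,4)] by simp
qed

lemma alternating_cycle_length_le:
  fixes xs ys :: "'n::finite list"
  assumes "(xs, ys) \<in> alternating_cycles k"
  shows "k \<le> CARD('n)"
  using assms distinct_card[of xs] card_mono[of UNIV "set xs"]
  by (auto simp: alternating_cycles_def)

section \<open>The edge-directions of the Birkhoff polytope\<close>

lemma edge_direction_classes_birkhoff_polytope:
  "edge_direction_classes (birkhoff_polytope :: (real ^ 'n ^ 'n::finite) set)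
    = (\<lambda>d. parallel_rel `` {d}) ` (\<Union>k\<in>{2..CARD('n)}. cycle_directions k)"
    (is "_ = ?q ` ?D")
proof -
  have "?q d \<in> ?q ` ?D" if d: "d \<in> edge_directions birkhoff_polytope" for d :: "real ^ 'n ^ 'n"
  proof -
    obtain u v c where uv: "closed_segment u v edge_of (birkhoff_polytope :: (real ^ 'n ^ 'n) set)"
        "c \<noteq> 0" "d = c *\<^sub>R (v - u)"
      using d by (auto simp: edge_directions_def)
    obtain k xs ys b where k: "2 \<le> k" "(xs, ys) \<in> alternating_cycles k" "b \<noteq> 0"
        "v - u = b *\<^sub>R cycle_matrix xs ys"
      using edge_parallel_to_cycle_matrix[OF uv(1)] by metis
    have "d = (c * b) *\<^sub>R cycle_matrix xs ys" "c * b \<noteq> 0"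
      using uv k by auto
    then have "(cycle_matrix xs ys, d) \<in> parallel_rel"
      unfolding parallel_rel_def by blast
    then have "?q d = ?q (cycle_matrix xs ys)"
      using equiv_class_eq[OF equiv_parallel_rel] by metis
    moreover have "cycle_matrix xs ys \<in> ?D"
      using k(1,2) alternating_cycle_length_le[OF k(2)] by (force simp: cycle_directions_def)
    ultimately show ?thesis by blast
  qed
  moreover have "?D \<subseteq> edge_directions birkhoff_polytope"
  proof
    fix d :: "real ^ 'n ^ 'n" assume "d \<in> ?D"
    then obtain k xs ys where "2 \<le> k" "(xs, ys) \<in> alternating_cycles k" "d = cycle_matrix xs ys"
      by (auto simp: cycle_directions_def)
    then obtain u v where "closed_segment u v edge_of (birkhoff_polytope :: (real ^ 'n ^ 'n) set)"
        "d = 1 *\<^sub>R (v - u)"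
      using cycle_matrix_is_edge by (metis scaleR_one)
    then show "d \<in> edge_directions birkhoff_polytope"
      unfolding edge_directions_def by (intro CollectI exI[of _ u] exI[of _ v] exI[of _ 1]) simp
  qed
  ultimately show ?thesis
    unfolding edge_direction_classes_def quotient_def by blast
qed

text \<open>
  Each parallel class meets the set of cycle matrices in exactly two elements \<open>d\<close> and \<open>- d\<close>.
\<close>
lemma two_card_edge_direction_classes:
  "2 * card (edge_direction_classes (birkhoff_polytope :: (real ^ 'n ^ 'n::finite) set))
    = card (\<Union>k\<in>{2..CARD('n)}. cycle_directions k :: (real ^ 'n ^ 'n) set)"
proof -
  define D where "D = (\<Union>k\<in>{2..CARD('n)}. cycle_directions k :: (real ^ 'n ^ 'n) set)"
  define q where "q d = parallel_rel `` {d}" for d :: "real ^ 'n ^ 'n"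
  have fin: "finite D"
    by (auto simp: D_def cycle_directions_def intro!: finite_imageI card_alternating_cycles(2))
  have fibre: "{e \<in> D. q e = q d} = {d, - d}" and nz: "d \<noteq> 0" if d: "d \<in> D" for d
  proof -
    obtain k xs ys where k: "2 \<le> k" "(xs, ys) \<in> alternating_cycles k" "d = cycle_matrix xs ys"
      using d by (auto simp: D_def cycle_directions_def)
    show "d \<noteq> 0"
      using k cycle_matrix_nonzero by metis
    have "e \<in> {d, - d}" if e: "e \<in> D" "q e = q d" for e
    proof -
      obtain k' xs' ys' where k': "2 \<le> k'" "(xs', ys') \<in> alternating_cycles k'" "e = cycle_matrix xs' ys'"
        using e by (auto simp: D_def cycle_directions_def)
      have "(d, e) \<in> parallel_rel"
        using e(2) eq_equiv_class_iff[OF equiv_parallel_rel UNIV_I UNIV_I] by (metis q_def)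
      then obtain c where "c \<noteq> 0" "e = c *\<^sub>R d"
        by (auto simp: parallel_rel_def)
      then show ?thesis
        using parallel_cycle_matrices[OF k(2,1) k'(2,1), of c] k k' by auto
    qed
    moreover have "- d \<in> D"
      using d cycle_directions_uminus by (auto simp: D_def)
    moreover have "q (- d) = q d"
    proof -
      have "(d, - d) \<in> parallel_rel"
        by (auto simp: parallel_rel_def intro: exI[of _ "-1"])
      then show ?thesis
        unfolding q_def using equiv_class_eq[OF equiv_parallel_rel] by metis
    qed
    ultimately show "{e \<in> D. q e = q d} = {d, - d}"
      using d by auto
  qed
  have "card D = (\<Sum>c\<in>q ` D. card {e \<in> D. q e = c})"
    using sum.image_gen[OF fin, of "\<lambda>_. 1" q] by (simp only: card_eq_sum)
  also have "\<dots> = (\<Sum>c\<in>q ` D. 2)"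
  proof (intro sum.cong refl)
    fix c assume "c \<in> q ` D"
    then obtain d where d: "d \<in> D" "c = q d" by auto
    have "d \<noteq> - d"
    proof
      assume "d = - d"
      then have "2 *\<^sub>R d = 0" by (simp add: scaleR_2 eq_neg_iff_add_eq_0)
      with nz[OF d(1)] show False by simp
    qed
    then show "card {e \<in> D. q e = c} = 2"
      using d fibre by simp
  qed
  finally show ?thesis
    by (simp add: edge_direction_classes_birkhoff_polytope D_def q_def)
qed

text \<open>
  The sets for different \<open>k\<close> are disjoint because \<open>k\<close> is the number of entries 1 of the matrix.
\<close>
lemma card_all_cycle_directions:
  "card (\<Union>k\<in>{2..CARD('n)}. cycle_directions k :: (real ^ 'n ^ 'n::finite) set)
    = (\<Sum>k = 2..CARD('n). (CARD('n) choose k)\<^sup>2 * fact k * fact (k - 1))"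
proof -
  have "card (\<Union>k\<in>{2..CARD('n)}. cycle_directions k :: (real ^ 'n ^ 'n) set)
      = (\<Sum>k = 2..CARD('n). card (cycle_directions k :: (real ^ 'n ^ 'n) set))"
  proof (rule card_UN_disjoint)
    show "\<forall>k\<in>{2..CARD('n)}. finite (cycle_directions k :: (real ^ 'n ^ 'n) set)"
      by (auto simp: cycle_directions_def intro!: finite_imageI card_alternating_cycles(2))
    show "\<forall>k\<in>{2..CARD('n)}. \<forall>l\<in>{2..CARD('n)}. k \<noteq> l \<longrightarrow>
        cycle_directions k \<inter> cycle_directions l = ({} :: (real ^ 'n ^ 'n) set)"
    proof (intro ballI impI equals0I)
      fix k l and d :: "real ^ 'n ^ 'n"
      assume kl: "k \<in> {2..CARD('n)}" "l \<in> {2..CARD('n)}" "k \<noteq> l"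
        and "d \<in> cycle_directions k \<inter> cycle_directions l"
      then obtain xs ys xs' ys' where "(xs, ys) \<in> alternating_cycles k" "d = cycle_matrix xs ys"
          "(xs', ys') \<in> alternating_cycles l" "d = cycle_matrix xs' ys'"
        by (auto simp: cycle_directions_def)
      with kl show False
        using cycle_matrix_length_unique[of xs ys k xs' ys' l] by simp
    qed
  qed simp
  then show ?thesis
    by (simp add: card_cycle_directions)
qed

theorem proposition2p3:
  fixes n :: nat
  assumes "n = CARD('n::finite)"
  shows "finite (edge_direction_classes (birkhoff_polytope :: (real ^ 'n ^ 'n) set))
    \<and> real (card (edge_direction_classes (birkhoff_polytope :: (real ^ 'n ^ 'n) set)))
        = 1 / 2 * (\<Sum>k = 2..n. (real (n choose k))\<^sup>2 * fact k * fact (k - 1))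
    \<and> 1 / 2 * (\<Sum>k = 2..n. (real (n choose k))\<^sup>2 * fact k * fact (k - 1))
        \<ge> 1 / real n * real (fact n choose 2)"
proof (intro conjI)
  show "finite (edge_direction_classes (birkhoff_polytope :: (real ^ 'n ^ 'n) set))"
    unfolding edge_direction_classes_birkhoff_polytope cycle_directions_def
    by (auto intro!: finite_imageI card_alternating_cycles(2))
  have "2 * real (card (edge_direction_classes (birkhoff_polytope :: (real ^ 'n ^ 'n) set)))
      = real (\<Sum>k = 2..n. (n choose k)\<^sup>2 * fact k * fact (k - 1))"
    using two_card_edge_direction_classes[where 'n = 'n] card_all_cycle_directions[where 'n = 'n]
    unfolding assms by (metis of_nat_mult of_nat_numeral)
  then show "real (card (edge_direction_classes (birkhoff_polytope :: (real ^ 'n ^ 'n) set)))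
      = 1 / 2 * (\<Sum>k = 2..n. (real (n choose k))\<^sup>2 * fact k * fact (k - 1))"
    by simp
  show "1 / real n * real (fact n choose 2)
      \<le> 1 / 2 * (\<Sum>k = 2..n. (real (n choose k))\<^sup>2 * fact k * fact (k - 1))"
  proof (cases "2 \<le> n")
    case False
    then have "n = 1"
      using assms by (cases n) auto
    then show ?thesis by (simp add: binomial_eq_0)
  next
    case True
    have "2 * real (fact n choose 2) = fact n * (fact n - 1 :: real)"
    proof -
      have "2 * (fact n choose 2) = fact n * (fact n - 1 :: nat)"
        by (simp add: choose_two)
      then have "real (2 * (fact n choose 2)) = real (fact n * (fact n - 1))"
        by simp
      then show ?thesis
        by (simp add: of_nat_diff)
    qed
    also have "\<dots> \<le> fact n * fact n"
      by (intro mult_left_mono) auto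
    finally have "real (fact n choose 2) \<le> 1 / 2 * (fact n * fact n)"
      by simp
    then have "1 / real n * real (fact n choose 2) \<le> 1 / real n * (1 / 2 * (fact n * fact n))"
      by (intro mult_left_mono) auto
    also have "\<dots> = 1 / 2 * (fact n * fact (n - 1))"
      using True by (simp add: fact_reduce[of n])
    also have "\<dots> \<le> 1 / 2 * (\<Sum>k = 2..n. (real (n choose k))\<^sup>2 * fact k * fact (k - 1))"
      using member_le_sum[of n "{2..n}" "\<lambda>k. (real (n choose k))\<^sup>2 * fact k * fact (k - 1)"] True
      by simp
    finally show ?thesis .
  qed
qed

end
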